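(* Let $t,r\ge1$ and $k_1,k_r,n\ge0$ be integers and let $c_1,\dots,c_t\ge0$ be integers. The number of partitions $\lambda$ such that $\lambda_1=k_1$, $\lambda_r=k_r$, $\lambda_r+\lambda_{t+r}+\lambda_{2t+r}+\cdots=n$, and $$c_i=\sum_{k\ge0}\bigl(\lambda_{kt+r+i-1}-\lambda_{kt+r+i}\bigr)\quad\text{for each }1\le i\le t,$$ equals the number of pairs $(\nu,\mu)$ where $\nu$ is a partition with at most $r-1$ parts and first part $\nu_1=k_1-k_r$, and $\mu$ is a $t$-colored partition of size $n$ with exactly $k_r$ parts in which, for each $1\le i\le t$, exactly $c_i$ parts have color $i$.
   Context: A partition is a weakly decreasing sequence of nonnegative integers $\lambda=(\lambda_1,\lambda_2,\dots)$, eventually zero, with $\lambda_i=0$ beyond the last nonzero part (the empty partition has first part $0$). A $t$-colored partition is a partition $(\lambda_1,\lambda_2,\dots,\lambda_\ell)$ together with a color $c_j\in\{1,\dots,t\}$ attached to each part $\lambda_j$, such that whenever $j<j'$ and $\lambda_j=\lambda_{j'}$ we have $c_j\ge c_{j'}$; its size is $\lambda_1+\cdots+\lambda_\ell$ (ignoring colors). *)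

theory Defs
  imports "HOL-Library.Groups_Big_Fun"
begin

text \<open>
  The value \<open>p i\<close> is the \<open>i\<close>-th part for \<open>i \<ge> 1\<close>. Index \<open>0\<close> carries no meaning and is pinned
  to \<open>0\<close> so that each partition is represented by exactly one function.
\<close>

definition is_partition :: "(nat \<Rightarrow> nat) \<Rightarrow> bool" where
  "is_partition p \<longleftrightarrow>
     p 0 = 0 \<and>
     (\<forall>i\<ge>1. \<forall>j\<ge>i. p j \<le> p i) \<and>
     (\<exists>N. \<forall>i\<ge>N. p i = 0)"

definition num_parts :: "(nat \<Rightarrow> nat) \<Rightarrow> nat" where
  "num_parts p = card {i. i \<ge> 1 \<and> p i \<noteq> 0}"

text \<open>
  A colored partition is the finite list of its (positive) parts, each paired with its color:
  \<open>[(p\<^sub>1, c\<^sub>1), \<dots>, (p\<^sub>l, c\<^sub>l)]\<close>.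
\<close>

definition is_colored_partition :: "nat \<Rightarrow> (nat \<times> nat) list \<Rightarrow> bool" where
  "is_colored_partition t m \<longleftrightarrow>
     (\<forall>j<length m. fst (m ! j) > 0 \<and> snd (m ! j) \<in> {1..t}) \<and>
     (\<forall>j j'. j < j' \<and> j' < length m \<longrightarrow> fst (m ! j) \<ge> fst (m ! j')) \<and>
     (\<forall>j j'. j < j' \<and> j' < length m \<and> fst (m ! j) = fst (m ! j')
        \<longrightarrow> snd (m ! j) \<ge> snd (m ! j'))"

definition colored_size :: "(nat \<times> nat) list \<Rightarrow> nat" where
  "colored_size m = sum_list (map fst m)"

definition num_parts_of_color :: "nat \<Rightarrow> (nat \<times> nat) list \<Rightarrow> nat" where
  "num_parts_of_color i m = card {j. j < length m \<and> snd (m ! j) = i}"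

end

theory Submission
  imports Defs
begin

text \<open>
  Cut the Young diagram of \<open>\<lambda>\<close> into the part of the first \<open>r - 1\<close> rows lying to the right of column
  \<open>\<lambda>\<^sub>r\<close>, which is \<open>\<nu>\<close>, and the diagram \<open>\<tau>\<close> of the rows \<open>r, r + 1, \<dots>\<close>. A column of \<open>\<tau>\<close> of length
  \<open>(a - 1) t + b\<close> with \<open>1 \<le> b \<le> t\<close> becomes a part \<open>a\<close> of color \<open>b\<close>; decreasing order of the column
  lengths is decreasing lexicographic order of the pairs \<open>(a, b)\<close>. Such a column meets exactly \<open>a\<close> of
  the rows \<open>r, r + t, r + 2t, \<dots>\<close> of \<open>\<lambda>\<close>, and \<open>\<lambda>\<^sub>m - \<lambda>\<^sub>m\<^sub>+\<^sub>1\<close> counts the columns ending in row \<open>m\<close>.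
\<close>

section \<open>Conjugation\<close>

text \<open>Rows are numbered from \<open>0\<close>, so that row \<open>0\<close> of the cut-off
  diagram is row \<open>r\<close> of the partition; here index \<open>0\<close> carries data, unlike
  in \<open>is_partition\<close>.\<close>

definition diagrams :: "(nat \<Rightarrow> nat) set" where
  "diagrams = {\<tau>. antimono \<tau> \<and> (\<exists>N. \<forall>m\<ge>N. \<tau> m = 0)}"

text \<open>Zeros are excluded because \<open>rows\<close> cannot see an empty column; without this,
  conjugation would not be injective.\<close>

definition decreasing_lists :: "nat list set" where
  "decreasing_lists = {L. sorted_wrt (\<ge>) L \<and> 0 \<notin> set L}"

definition columns :: "(nat \<Rightarrow> nat) \<Rightarrow> nat list" where
  "columns \<tau> = map (\<lambda>j. card {m. j < \<tau> m}) [0..<\<tau> 0]"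

definition rows :: "nat list \<Rightarrow> nat \<Rightarrow> nat" where
  "rows L m = card {j. j < length L \<and> m < L ! j}"

text \<open>Turns the cardinalities in \<open>columns\<close> and \<open>rows\<close> into
  thresholds: membership in such a set becomes a comparison with its cardinality.\<close>

lemma down_closed_nat_eq_lessThan:
  fixes S :: "nat set"
  assumes "finite S" and "\<And>x y. x \<in> S \<Longrightarrow> y \<le> x \<Longrightarrow> y \<in> S"
  shows "S = {..<card S}"
proof (cases "S = {}")
  case False
  have "S = {..Max S}"
    using assms False by (auto intro: Max_in)
  then obtain a where "S = {..a}" ..
  then show ?thesis by auto
qed simp

lemma length_columns [simp]: "length (columns \<tau>) = \<tau> 0"
  by (simp add: columns_def)

text \<open>Both sides say that the diagram has a cell in row \<open>m\<close> and column
  \<open>j\<close>. Together with its mirror image \<open>less_rows_iff\<close> this carries the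
  whole conjugation argument.\<close>

lemma less_columns_iff:
  assumes "\<tau> \<in> diagrams" and "j < \<tau> 0"
  shows "m < columns \<tau> ! j \<longleftrightarrow> j < \<tau> m"
proof -
  from assms(1) obtain N where anti: "antimono \<tau>" and N: "\<And>m. m \<ge> N \<Longrightarrow> \<tau> m = 0"
    by (auto simp: diagrams_def)
  have "{m. j < \<tau> m} \<subseteq> {..<N}"
    using N by (auto simp: not_le[symmetric])
  then have "finite {m. j < \<tau> m}"
    using finite_subset by blast
  then have "{m. j < \<tau> m} = {..<card {m. j < \<tau> m}}"
    by (rule down_closed_nat_eq_lessThan)
      (use anti in \<open>auto dest: antimonoD intro: less_le_trans\<close>)
  then have "j < \<tau> m \<longleftrightarrow> m < card {m. j < \<tau> m}"
    by blast
  with assms(2) show ?thesis by (simp add: columns_def)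
qed

lemma less_rows_iff:
  assumes "L \<in> decreasing_lists" and "j < length L"
  shows "j < rows L m \<longleftrightarrow> m < L ! j"
proof -
  let ?S = "{j. j < length L \<and> m < L ! j}"
  have "L ! x \<le> L ! y" if "y \<le> x" "x < length L" for x y
    using assms(1) that by (cases "x = y") (auto simp: decreasing_lists_def sorted_wrt_iff_nth_less)
  then have "?S = {..<card ?S}"
    by (intro down_closed_nat_eq_lessThan) (auto intro: less_le_trans)
  then have "j \<in> ?S \<longleftrightarrow> j < card ?S"
    by blast
  with assms(2) show ?thesis by (simp add: rows_def)
qed

lemma columns_in_decreasing_lists:
  assumes "\<tau> \<in> diagrams"
  shows "columns \<tau> \<in> decreasing_lists"
proof -
  have "columns \<tau> ! j' \<le> columns \<tau> ! j" if "j < j'" "j' < \<tau> 0" for j j'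
  \<comment> \<open>If column \<open>j'\<close> were longer, it would have a cell in the row just
    below the end of column \<open>j\<close>; that row then reaches past \<open>j\<close> as well, a
    contradiction.\<close>
  proof (rule ccontr)
    assume "\<not> ?thesis"
    then have "columns \<tau> ! j < columns \<tau> ! j'" by simp
    then have "j' < \<tau> (columns \<tau> ! j)"
      using assms that less_columns_iff by blast
    then have "columns \<tau> ! j < columns \<tau> ! j"
      using assms that less_columns_iff[of \<tau> j "columns \<tau> ! j"] by simp
    then show False by simp
  qed
  moreover have "0 \<notin> set (columns \<tau>)"
    using assms less_columns_iff[of \<tau> _ 0] by (auto simp: in_set_conv_nth)
  ultimately show ?thesis
    by (simp add: decreasing_lists_def sorted_wrt_iff_nth_less)
qed

lemma rows_zero:
  assumes "0 \<notin> set L"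
  shows "rows L 0 = length L"
proof -
  have "{j. j < length L \<and> 0 < L ! j} = {..<length L}"
    using assms by (auto simp: in_set_conv_nth)
  then show ?thesis by (simp add: rows_def)
qed

lemma rows_in_diagrams: "rows L \<in> diagrams"
proof -
  have "rows L m = 0" if "m \<ge> Max (insert 0 (set L))" for m
  proof -
    have "L ! j \<le> m" if "j < length L" for j
      using \<open>m \<ge> _\<close> nth_mem[OF that] by simp
    then show ?thesis by (auto simp: rows_def not_less[symmetric])
  qed
  moreover have "antimono (rows L)"
    unfolding rows_def by (auto intro!: antimonoI card_mono)
  ultimately show ?thesis unfolding diagrams_def by blast
qed

lemma rows_columns:
  assumes "\<tau> \<in> diagrams"
  shows "rows (columns \<tau>) = \<tau>"
proof
  fix m
  \<comment> \<open>Row \<open>0\<close> is the longest, so the bound \<open>j < \<tau> 0\<close>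
    built into the list of columns cuts nothing off row \<open>m\<close>.\<close>
  have "\<tau> m \<le> \<tau> 0"
    using assms by (auto simp: diagrams_def dest: antimonoD)
  then have "{j. j < \<tau> 0 \<and> m < columns \<tau> ! j} = {..<\<tau> m}"
    using less_columns_iff[OF assms] by auto
  then show "rows (columns \<tau>) m = \<tau> m"
    by (simp add: rows_def)
qed

lemma columns_rows:
  assumes "L \<in> decreasing_lists"
  shows "columns (rows L) = L"
proof (rule nth_equalityI)
  show len: "length (columns (rows L)) = length L"
    using assms by (simp add: rows_zero decreasing_lists_def)
  fix j assume "j < length (columns (rows L))"
  then have "m < columns (rows L) ! j \<longleftrightarrow> m < L ! j" for m
    using less_columns_iff[OF rows_in_diagrams] less_rows_iff[OF assms] len by simp
  \<comment> \<open>Two naturals with the same strict lower bounds are equal.\<close>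
  then show "columns (rows L) ! j = L ! j"
    by (meson linorder_neqE_nat less_irrefl)
qed

lemma bij_betw_columns: "bij_betw columns diagrams decreasing_lists"
  by (rule bij_betw_byWitness[where f' = rows])
    (auto simp: rows_columns columns_rows columns_in_decreasing_lists rows_in_diagrams)

section \<open>Column lengths as colored parts\<close>

text \<open>Division with remainders taken in \<open>{1..t}\<close> instead of
  \<open>{0..<t}\<close>: a multiple of \<open>t\<close> gets color \<open>t\<close>. Truncated
  subtraction gives \<open>0\<close> and \<open>1\<close> the same image, hence the positivity
  assumptions below.\<close>

definition color :: "nat \<Rightarrow> nat \<Rightarrow> nat \<times> nat" where
  "color t x = ((x - 1) div t + 1, (x - 1) mod t + 1)"

definition uncolor :: "nat \<Rightarrow> nat \<times> nat \<Rightarrow> nat" where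
  "uncolor t = (\<lambda>(a, b). (a - 1) * t + b)"

lemma uncolor_color: "x > 0 \<Longrightarrow> uncolor t (color t x) = x"
  by (simp add: uncolor_def color_def)

lemma color_uncolor:
  assumes "fst y > 0" and "snd y \<in> {1..t}"
  shows "color t (uncolor t y) = y"
proof -
  obtain a b where y: "y = (Suc a, Suc b)" "b < t"
    using assms by (cases y) (auto simp: gr0_conv_Suc Suc_le_eq dest!: Suc_le_D)
  then show ?thesis by (simp add: color_def uncolor_def)
qed

text \<open>Quotient and remainder compare lexicographically. The right-hand side is split like the
  two order clauses of \<open>is_colored_partition\<close>.\<close>

lemma color_le_iff:
  assumes "t \<ge> 1" and "x > 0" and "y > 0"
  shows "y \<le> x \<longleftrightarrow> fst (color t y) \<le> fst (color t x) \<and>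
    (fst (color t x) = fst (color t y) \<longrightarrow> snd (color t y) \<le> snd (color t x))"
    (is "_ \<longleftrightarrow> ?R")
proof -
  obtain a b where x: "x = Suc a" "y = Suc b"
    using assms by (auto simp: gr0_conv_Suc)
  have *: "a div t \<le> b div t \<and> (b div t = a div t \<longrightarrow> a mod t \<le> b mod t)" if "a \<le> b" for a b
    using that div_le_mono[of a b t] div_mult_mod_eq[of a t] div_mult_mod_eq[of b t]
    by (metis nat_add_left_cancel_le)
  \<comment> \<open>Otherwise \<open>a < b\<close>, and \<open>*\<close> together with
    \<open>?R\<close> forces equal quotients and equal remainders, so \<open>a = b\<close>.\<close>
  have "b \<le> a" if "?R"
  proof (rule ccontr)
    assume "\<not> b \<le> a"
    then have "a \<le> b" "a \<noteq> b" by auto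
    with *[of a b] that x have "a div t = b div t" "a mod t = b mod t"
      by (auto simp: color_def)
    with \<open>a \<noteq> b\<close> show False
      by (metis div_mult_mod_eq)
  qed
  then show ?thesis
    using *[of b a] x by (auto simp: color_def)
qed

text \<open>Apply \<open>color_le_iff\<close> to every pair of positions; values of
  \<open>color\<close> always satisfy the positivity and range clauses. As an equivalence it serves
  both inclusions of the bijection below.\<close>

lemma colored_partition_map_color_iff:
  assumes "t \<ge> 1" and "0 \<notin> set L"
  shows "is_colored_partition t (map (color t) L) \<longleftrightarrow> L \<in> decreasing_lists"
proof -
  have pos: "0 < L ! j" if "j < length L" for j
    using assms(2) that by (metis gr0I nth_mem)
  have range: "fst (color t x) > 0 \<and> snd (color t x) \<in> {1..t}" for x
    using assms(1) by (simp add: color_def Suc_le_eq)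
  have le: "L ! j' \<le> L ! j \<longleftrightarrow> fst (color t (L ! j')) \<le> fst (color t (L ! j)) \<and>
      (fst (color t (L ! j)) = fst (color t (L ! j')) \<longrightarrow>
        snd (color t (L ! j')) \<le> snd (color t (L ! j)))" if "j < j'" "j' < length L" for j j'
    using that pos by (intro color_le_iff assms(1)) auto
  have "L \<in> decreasing_lists \<longleftrightarrow> (\<forall>j j'. j < j' \<and> j' < length L \<longrightarrow> L ! j' \<le> L ! j)"
    using assms(2) by (auto simp: decreasing_lists_def sorted_wrt_iff_nth_less)
  then show ?thesis
    unfolding is_colored_partition_def using range le by (auto simp del: atLeastAtMost_iff)
qed

lemma bij_betw_map_color:
  assumes "t \<ge> 1"
  shows "bij_betw (map (color t)) decreasing_lists {\<mu>. is_colored_partition t \<mu>}"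
proof (rule bij_betw_byWitness[where f' = "map (uncolor t)"])
  show "\<forall>L\<in>decreasing_lists. map (uncolor t) (map (color t) L) = L"
    by (auto simp: decreasing_lists_def intro!: map_idI uncolor_color gr0I)
  have parts: "fst y > 0 \<and> snd y \<in> {1..t}" if "is_colored_partition t \<mu>" "y \<in> set \<mu>" for \<mu> y
    using that unfolding is_colored_partition_def in_set_conv_nth by blast
  have inv: "map (color t) (map (uncolor t) \<mu>) = \<mu>" if "is_colored_partition t \<mu>" for \<mu>
    using parts[OF that] color_uncolor by (simp add: map_idI)
  then show "\<forall>\<mu>\<in>{\<mu>. is_colored_partition t \<mu>}. map (color t) (map (uncolor t) \<mu>) = \<mu>"
    by blast
  show "map (color t) ` decreasing_lists \<subseteq> {\<mu>. is_colored_partition t \<mu>}"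
    using colored_partition_map_color_iff[OF assms] by (auto simp: decreasing_lists_def)
  show "map (uncolor t) ` {\<mu>. is_colored_partition t \<mu>} \<subseteq> decreasing_lists"
  proof safe
    fix \<mu> assume \<mu>: "is_colored_partition t \<mu>"
    have "0 \<notin> set (map (uncolor t) \<mu>)"
      using parts[OF \<mu>] by (force simp: uncolor_def split_beta)
    \<comment> \<open>Recoloring the uncolored list returns \<open>\<mu>\<close>, so the equivalence
      can be read from right-hand knowledge about \<open>\<mu>\<close> back to the list.\<close>
    then show "map (uncolor t) \<mu> \<in> decreasing_lists"
      using colored_partition_map_color_iff[OF assms] inv[OF \<mu>] \<mu> by metis
  qed
qed

section \<open>Size and color statistics\<close>

text \<open>Double counting of the pairs \<open>(j, k)\<close> with \<open>P j k\<close>. Since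
  \<open>Sum_any\<close> is \<open>0\<close> on infinite support, the finiteness assumptions are
  used to confine the support to the finite set \<open>?K\<close>.\<close>

lemma Sum_any_card_swap:
  assumes "finite J" and "\<And>j. j \<in> J \<Longrightarrow> finite {k. P j k}"
  shows "Sum_any (\<lambda>k. card {j \<in> J. P j k}) = (\<Sum>j\<in>J. card {k. P j k})"
proof -
  let ?K = "\<Union>j\<in>J. {k. P j k}"
  have fin: "finite ?K"
    using assms by blast
  have "{k. card {j \<in> J. P j k} \<noteq> 0} \<subseteq> ?K"
    by (auto simp: card_eq_0_iff)
  then have "Sum_any (\<lambda>k. card {j \<in> J. P j k}) = (\<Sum>k\<in>?K. card {j \<in> J. P j k})"
    using fin by (intro Sum_any.expand_superset)
  also have "\<dots> = (\<Sum>k\<in>?K. \<Sum>j\<in>J. of_bool (P j k))"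
    using assms(1) by (simp add: Int_def)
  also have "\<dots> = (\<Sum>j\<in>J. \<Sum>k\<in>?K. of_bool (P j k))"
    by (rule sum.swap)
  also have "\<dots> = (\<Sum>j\<in>J. card {k. P j k})"
  proof (rule sum.cong)
    fix j assume "j \<in> J"
    then have "?K \<inter> {k. P j k} = {k. P j k}" by blast
    then show "(\<Sum>k\<in>?K. of_bool (P j k)) = card {k. P j k}"
      using fin by simp
  qed simp
  finally show ?thesis .
qed

text \<open>These \<open>k\<close> index the rows \<open>0, t, 2t, ...\<close> met by a column of
  length \<open>x\<close>; their number is the part \<open>fst (color t x)\<close>.\<close>

lemma multiples_below_eq:
  fixes t x :: nat
  assumes "t \<ge> 1" and "x > 0"
  shows "{k. k * t < x} = {..<(x - 1) div t + 1}"
proof -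
  have "k * t < x \<longleftrightarrow> k \<le> (x - 1) div t" for k
    using assms by (subst less_eq_div_iff_mult_less_eq) auto
  then show ?thesis
    by (simp add: set_eq_iff less_Suc_eq_le)
qed

text \<open>Uniqueness of division of \<open>x - 1\<close> by \<open>t\<close>: the cardinality of
  this set is the indicator of \<open>x\<close> having color \<open>i\<close>.\<close>

lemma residue_indices:
  fixes t x i :: nat
  assumes "i \<in> {1..t}" and "x > 0"
  shows "{k. x = k * t + i} = (if (x - 1) mod t + 1 = i then {(x - 1) div t} else {})"
proof -
  obtain a b where x: "x = Suc a" "i = Suc b" "b < t"
    using assms by (cases x; cases i) auto
  have "a = k * t + b \<longleftrightarrow> a mod t = b \<and> k = a div t" for k
    using x(3) by auto
  then show ?thesis using x by auto
qed

text \<open>Count the cells in rows \<open>0, t, 2t, ...\<close> column by column: each column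
  contributes exactly its part.\<close>

lemma colored_size_columns:
  assumes "t \<ge> 1" and "\<tau> \<in> diagrams"
  shows "colored_size (map (color t) (columns \<tau>)) = Sum_any (\<lambda>k. \<tau> (k * t))"
proof -
  let ?L = "columns \<tau>"
  have pos: "0 < ?L ! j" if "j < \<tau> 0" for j
    using less_columns_iff[OF assms(2) that] that by simp
  have set: "{k. k * t < ?L ! j} = {..<(?L ! j - 1) div t + 1}" if "j < \<tau> 0" for j
    using multiples_below_eq assms(1) pos that by blast
  have "\<tau> m = card {j \<in> {..<\<tau> 0}. m < ?L ! j}" for m
    using fun_cong[OF rows_columns[OF assms(2)], of m] by (simp add: rows_def)
  then have "Sum_any (\<lambda>k. \<tau> (k * t)) = Sum_any (\<lambda>k. card {j \<in> {..<\<tau> 0}. k * t < ?L ! j})"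
    by metis
  also have "\<dots> = (\<Sum>j<\<tau> 0. card {k. k * t < ?L ! j})"
    by (rule Sum_any_card_swap) (auto simp: set)
  also have "\<dots> = (\<Sum>j<\<tau> 0. (?L ! j - 1) div t + 1)"
    by (rule sum.cong) (simp_all add: set)
  also have "\<dots> = colored_size (map (color t) ?L)"
    by (simp add: colored_size_def sum_list_sum_nth color_def atLeast0LessThan)
  finally show ?thesis ..
qed

lemma num_parts_of_color_columns:
  assumes "i \<in> {1..t}" and "\<tau> \<in> diagrams"
  shows "int (num_parts_of_color i (map (color t) (columns \<tau>))) =
    Sum_any (\<lambda>k. int (\<tau> (k * t + i - 1)) - int (\<tau> (k * t + i)))"
proof -
  let ?L = "columns \<tau>" and ?J = "{..<\<tau> 0}"
  have pos: "0 < ?L ! j" if "j < \<tau> 0" for j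
    using less_columns_iff[OF assms(2) that] that by simp
  have set: "{k. ?L ! j = k * t + i} =
      (if (?L ! j - 1) mod t + 1 = i then {(?L ! j - 1) div t} else {})" if "j < \<tau> 0" for j
    using residue_indices assms(1) pos that by blast
  have \<tau>: "\<tau> m = card {j \<in> ?J. m < ?L ! j}" for m
    using fun_cong[OF rows_columns[OF assms(2)], of m] by (simp add: rows_def)
  \<comment> \<open>Columns longer than \<open>m - 1\<close> are those longer than \<open>m\<close>
    and those of length exactly \<open>m\<close>. Positivity of \<open>m\<close> keeps the
    subtraction honest; below it comes from \<open>i \<ge> 1\<close>.\<close>
  have diff: "int (\<tau> (m - 1)) - int (\<tau> m) = int (card {j \<in> ?J. ?L ! j = m})" if "m > 0" for m
  proof -
    have "{j \<in> ?J. m - 1 < ?L ! j} = {j \<in> ?J. m < ?L ! j} \<union> {j \<in> ?J. ?L ! j = m}"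
      using that by auto
    then have "\<tau> (m - 1) = \<tau> m + card {j \<in> ?J. ?L ! j = m}"
      unfolding \<tau>[of m] \<tau>[of "m - 1"] by (simp only:) (rule card_Un_disjoint, auto)
    then show ?thesis by simp
  qed
  have "Sum_any (\<lambda>k. int (\<tau> (k * t + i - 1)) - int (\<tau> (k * t + i))) =
      Sum_any (\<lambda>k. int (card {j \<in> ?J. ?L ! j = k * t + i}))"
    by (intro arg_cong[where f = Sum_any] ext diff) (use assms(1) in simp)
  \<comment> \<open>A count and its image under \<open>int\<close> vanish for the same
    \<open>k\<close>, so both sums have the same support.\<close>
  also have "\<dots> = int (Sum_any (\<lambda>k. card {j \<in> ?J. ?L ! j = k * t + i}))"
    by (simp add: Sum_any.expand_set)
  also have "Sum_any (\<lambda>k. card {j \<in> ?J. ?L ! j = k * t + i}) =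
      (\<Sum>j\<in>?J. card {k. ?L ! j = k * t + i})"
    by (rule Sum_any_card_swap) (auto simp: set)
  also have "\<dots> = (\<Sum>j\<in>?J. of_bool ((?L ! j - 1) mod t + 1 = i))"
    by (rule sum.cong) (simp_all add: set)
  also have "\<dots> = card {j \<in> ?J. (?L ! j - 1) mod t + 1 = i}"
    by (simp add: Int_def)
  also have "\<dots> = num_parts_of_color i (map (color t) ?L)"
    unfolding num_parts_of_color_def
    by (rule arg_cong[where f = card]) (auto simp: color_def)
  finally show ?thesis ..
qed

section \<open>Cutting a partition at its \<open>r\<close>-th row\<close>

text \<open>The subtraction never truncates on a partition, since \<open>p r \<le> p i\<close> for
  \<open>1 \<le> i < r\<close>. For \<open>r = 1\<close> the result is the empty partition.\<close>

definition head :: "nat \<Rightarrow> (nat \<Rightarrow> nat) \<Rightarrow> nat \<Rightarrow> nat" where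
  "head r p i = (if 1 \<le> i \<and> i < r then p i - p r else 0)"

definition tail :: "nat \<Rightarrow> (nat \<Rightarrow> nat) \<Rightarrow> nat \<Rightarrow> nat" where
  "tail r p m = p (m + r)"

definition glue :: "nat \<Rightarrow> (nat \<Rightarrow> nat) \<Rightarrow> (nat \<Rightarrow> nat) \<Rightarrow> nat \<Rightarrow> nat" where
  "glue r \<nu> \<tau> i = (if i = 0 then 0 else if i < r then \<nu> i + \<tau> 0 else \<tau> (i - r))"

text \<open>By monotonicity a nonzero part at some index \<open>i \<ge> r\<close> makes all of
  \<open>{1..r}\<close> nonzero. The pointwise form is what gluing can use.\<close>

lemma num_parts_le_iff:
  assumes "is_partition \<nu>" and "r \<ge> 1"
  shows "num_parts \<nu> \<le> r - 1 \<longleftrightarrow> (\<forall>i\<ge>r. \<nu> i = 0)"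
proof
  let ?S = "{i. i \<ge> 1 \<and> \<nu> i \<noteq> 0}"
  from assms(1) obtain N where N: "\<And>i. i \<ge> N \<Longrightarrow> \<nu> i = 0"
    and anti: "\<And>i j. 1 \<le> i \<Longrightarrow> i \<le> j \<Longrightarrow> \<nu> j \<le> \<nu> i"
    unfolding is_partition_def by blast
  have "i < N" if "\<nu> i \<noteq> 0" for i
    using N that by (meson not_le)
  then have "?S \<subseteq> {..<N}" by blast
  then have fin: "finite ?S"
    using finite_subset by blast
  show "\<forall>i\<ge>r. \<nu> i = 0" if le: "num_parts \<nu> \<le> r - 1"
  proof (rule ccontr)
    assume "\<not> ?thesis"
    then obtain i where i: "i \<ge> r" "\<nu> i \<noteq> 0" by blast
    have "{1..r} \<subseteq> ?S"
      using i anti[of _ i] by fastforce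
    then have "card {1..r} \<le> num_parts \<nu>"
      unfolding num_parts_def using fin by (rule card_mono[rotated])
    with le assms(2) show False by simp
  qed
  show "num_parts \<nu> \<le> r - 1" if "\<forall>i\<ge>r. \<nu> i = 0"
  proof -
    have "i < r" if "\<nu> i \<noteq> 0" for i
      using \<open>\<forall>i\<ge>r. \<nu> i = 0\<close> that by (meson not_le)
    then have "?S \<subseteq> {1..<r}" by auto
    then have "num_parts \<nu> \<le> card {1..<r}"
      unfolding num_parts_def by (rule card_mono[rotated]) simp
    then show ?thesis by simp
  qed
qed

text \<open>The target is a full product because any two pieces fit: \<open>glue\<close> adds
  \<open>\<tau> 0\<close>, which plays the role of \<open>p r\<close>, to each of the first
  \<open>r - 1\<close> rows.\<close>

lemma bij_betw_head_tail:
  assumes "r \<ge> 1"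
  shows "bij_betw (\<lambda>p. (head r p, tail r p)) {p. is_partition p}
    ({\<nu>. is_partition \<nu> \<and> num_parts \<nu> \<le> r - 1} \<times> diagrams)"
proof -
  have eq: "{\<nu>. is_partition \<nu> \<and> num_parts \<nu> \<le> r - 1} = {\<nu>. is_partition \<nu> \<and> (\<forall>i\<ge>r. \<nu> i = 0)}"
    using num_parts_le_iff[OF _ assms] by auto
  show ?thesis
    unfolding eq
  proof (rule bij_betw_byWitness[where f' = "\<lambda>(\<nu>, \<tau>). glue r \<nu> \<tau>"])
    show "\<forall>p\<in>{p. is_partition p}. (case (head r p, tail r p) of (\<nu>, \<tau>) \<Rightarrow> glue r \<nu> \<tau>) = p"
      by (auto simp: fun_eq_iff glue_def head_def tail_def is_partition_def)
    show "\<forall>x\<in>{\<nu>. is_partition \<nu> \<and> (\<forall>i\<ge>r. \<nu> i = 0)} \<times> diagrams.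
        (head r (case x of (\<nu>, \<tau>) \<Rightarrow> glue r \<nu> \<tau>), tail r (case x of (\<nu>, \<tau>) \<Rightarrow> glue r \<nu> \<tau>)) = x"
      using assms by (auto simp: fun_eq_iff glue_def head_def tail_def is_partition_def
          not_less_eq_eq[symmetric])
    show "(\<lambda>p. (head r p, tail r p)) ` {p. is_partition p} \<subseteq>
        {\<nu>. is_partition \<nu> \<and> (\<forall>i\<ge>r. \<nu> i = 0)} \<times> diagrams"
    proof clarsimp
      fix p assume p: "is_partition p"
      have "is_partition (head r p)"
        using p by (auto simp: is_partition_def head_def intro!: diff_le_mono exI[of _ r])
      moreover have "tail r p \<in> diagrams"
        using p assms unfolding is_partition_def diagrams_def tail_def
        by (auto intro!: antimonoI) (meson trans_le_add1)
      ultimately show "is_partition (head r p) \<and> (\<forall>i\<ge>r. head r p i = 0) \<and> tail r p \<in> diagrams"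
        by (auto simp: head_def)
    qed
    show "(\<lambda>(\<nu>, \<tau>). glue r \<nu> \<tau>) ` ({\<nu>. is_partition \<nu> \<and> (\<forall>i\<ge>r. \<nu> i = 0)} \<times> diagrams) \<subseteq>
        {p. is_partition p}"
    proof clarsimp
      fix \<nu> \<tau> assume \<nu>: "is_partition \<nu>" and \<tau>: "\<tau> \<in> diagrams"
      from \<tau> obtain N where anti: "antimono \<tau>" and N: "\<And>m. m \<ge> N \<Longrightarrow> \<tau> m = 0"
        by (auto simp: diagrams_def)
      \<comment> \<open>This settles the comparison across the cut, with
        \<open>i < r \<le> j\<close>; on either side of it \<open>\<nu>\<close> or
        \<open>\<tau>\<close> alone decides.\<close>
      have "\<tau> m \<le> \<nu> i + \<tau> 0" for m i
        using antimonoD[OF anti, of 0 m] by simp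
      then have "glue r \<nu> \<tau> j \<le> glue r \<nu> \<tau> i" if "1 \<le> i" "i \<le> j" for i j
        using that \<nu> antimonoD[OF anti] by (auto simp: glue_def is_partition_def)
      moreover have "glue r \<nu> \<tau> i = 0" if "i \<ge> N + r" for i
        using that N by (simp add: glue_def)
      moreover have "glue r \<nu> \<tau> 0 = 0"
        by (simp add: glue_def)
      ultimately show "is_partition (glue r \<nu> \<tau>)"
        unfolding is_partition_def by blast
    qed
  qed
qed

section \<open>Transport of the conditions along the composed bijection\<close>

lemma card_Collect_bij_betw:
  assumes "bij_betw f A B" and "\<And>a. a \<in> A \<Longrightarrow> P a \<longleftrightarrow> Q (f a)"
  shows "card {a \<in> A. P a} = card {b \<in> B. Q b}"
proof -
  have "f ` {a \<in> A. P a} = {b \<in> B. Q b}"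
    using assms by (auto simp: bij_betw_def)
  then have "bij_betw f {a \<in> A. P a} {b \<in> B. Q b}"
    using assms(1) by (auto intro: bij_betw_subset)
  then show ?thesis
    by (rule bij_betw_same_card)
qed

theorem theorem6:
  fixes t r k1 kr n :: nat and c :: "nat \<Rightarrow> nat"
  assumes "t \<ge> 1" and "r \<ge> 1"
  shows "card {p. is_partition p \<and> p 1 = k1 \<and> p r = kr
              \<and> Sum_any (\<lambda>k. p (k * t + r)) = n
              \<and> (\<forall>i\<in>{1..t}. int (c i) =
                    Sum_any (\<lambda>k. int (p (k * t + r + i - 1)) - int (p (k * t + r + i))))}
       = card {(\<nu>, \<mu>). is_partition \<nu> \<and> num_parts \<nu> \<le> r - 1
              \<and> int (\<nu> 1) = int k1 - int kr
              \<and> is_colored_partition t \<mu> \<and> colored_size \<mu> = n \<and> length \<mu> = kr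
              \<and> (\<forall>i\<in>{1..t}. num_parts_of_color i \<mu> = c i)}"
proof -
  let ?N = "{\<nu>. is_partition \<nu> \<and> num_parts \<nu> \<le> r - 1}"
  define f where "f p = (head r p, map (color t) (columns (tail r p)))" for p
  define P where "P p \<longleftrightarrow> p 1 = k1 \<and> p r = kr \<and> Sum_any (\<lambda>k. p (k * t + r)) = n
      \<and> (\<forall>i\<in>{1..t}. int (c i) =
          Sum_any (\<lambda>k. int (p (k * t + r + i - 1)) - int (p (k * t + r + i))))" for p
  define Q where "Q = (\<lambda>(\<nu> :: nat \<Rightarrow> nat, \<mu>). int (\<nu> 1) = int k1 - int kr \<and> colored_size \<mu> = n
      \<and> length \<mu> = kr \<and> (\<forall>i\<in>{1..t}. num_parts_of_color i \<mu> = c i))"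
  have "bij_betw (map_prod id (map (color t) \<circ> columns)) (?N \<times> diagrams)
      (?N \<times> {\<mu>. is_colored_partition t \<mu>})"
    by (intro bij_betw_map_prod bij_betw_id
        bij_betw_trans[OF bij_betw_columns bij_betw_map_color] assms)
  from bij_betw_trans[OF bij_betw_head_tail[OF assms(2)] this]
  have bij: "bij_betw f {p. is_partition p} (?N \<times> {\<mu>. is_colored_partition t \<mu>})"
    by (simp add: f_def[abs_def] comp_def)
  have "P p \<longleftrightarrow> Q (f p)" if p: "p \<in> {p. is_partition p}" for p
  proof -
    let ?\<mu> = "map (color t) (columns (tail r p))"
    have \<tau>: "tail r p \<in> diagrams"
      using bij_betw_apply[OF bij_betw_head_tail[OF assms(2)] p] by simp
    have size: "colored_size ?\<mu> = Sum_any (\<lambda>k. p (k * t + r))"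
      using colored_size_columns[OF assms(1) \<tau>] by (simp add: tail_def)
    \<comment> \<open>Undoing the shift by \<open>r\<close> rewrites
      \<open>k * t + i - 1 + r\<close> as \<open>k * t + r + i - 1\<close>, which relies on
      \<open>i \<ge> 1\<close>.\<close>
    have count: "int (num_parts_of_color i ?\<mu>) =
        Sum_any (\<lambda>k. int (p (k * t + r + i - 1)) - int (p (k * t + r + i)))"
      if "i \<in> {1..t}" for i
      using num_parts_of_color_columns[OF that \<tau>] that by (simp add: tail_def add_ac)
    have colors: "(\<forall>i\<in>{1..t}. int (c i) =
          Sum_any (\<lambda>k. int (p (k * t + r + i - 1)) - int (p (k * t + r + i))))
        \<longleftrightarrow> (\<forall>i\<in>{1..t}. num_parts_of_color i ?\<mu> = c i)"
      by (intro ball_cong refl, subst count[symmetric]) auto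
    have "p r \<le> p 1"
      using p assms(2) by (simp add: is_partition_def)
    \<comment> \<open>For \<open>r = 1\<close> the head is zero and so is \<open>p 1 - p r\<close>.
      Stating this over the integers leaves both sides of the theorem empty when
      \<open>k1 < kr\<close>.\<close>
    then have "int (head r p 1) = int (p 1) - int (p r)"
      using assms(2) by (cases "r = 1") (auto simp: head_def)
    \<comment> \<open>The length of \<open>?\<mu>\<close> is the number of columns of the tail,
      namely \<open>p r\<close>; with it, the condition on \<open>\<nu> 1\<close> is equivalent to
      \<open>p 1 = k1\<close>.\<close>
    then show ?thesis
      unfolding P_def Q_def f_def prod.case colors size by (auto simp: tail_def)
  qed
  with bij have "card {p \<in> {p. is_partition p}. P p} =
      card {x \<in> ?N \<times> {\<mu>. is_colored_partition t \<mu>}. Q x}"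
    by (rule card_Collect_bij_betw)
  moreover have "{x \<in> ?N \<times> {\<mu>. is_colored_partition t \<mu>}. Q x} =
      {(\<nu>, \<mu>). is_partition \<nu> \<and> num_parts \<nu> \<le> r - 1
        \<and> int (\<nu> 1) = int k1 - int kr
        \<and> is_colored_partition t \<mu> \<and> colored_size \<mu> = n \<and> length \<mu> = kr
        \<and> (\<forall>i\<in>{1..t}. num_parts_of_color i \<mu> = c i)}"
    by (auto simp: Q_def)
  ultimately show ?thesis
    by (simp add: P_def)
qed

end
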